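(* Let $J\ge J_0$. For every $r\in L^2(dx)$ and $g\in\mathcal G(c,C)$, with $q_J(r;g)=\|P_J(rg)\|_2^2$, $$q_J(r;g)^{1/2}\le C\|r\|_2,$$ $$q_J(r;g)^{1/2}\ge c\|P_Jr\|_2-C\|(I-P_J)r\|_2,$$ $$q_J(r;g)^{1/2}\ge c\|r\|_2-(c+C)\|(I-P_J)r\|_2,$$ $$\|r\|_2^2\le\frac{2}{c^2}\,q_J(r;g)+\Big(1+\frac{2C^2}{c^2}\Big)\|(I-P_J)r\|_2^2.$$
   Context: Fix an integer $d\ge1$, $\mathcal X=[0,1]^d$, and $0<c\le1\le C<\infty$. Write $\|h\|_2^2=\int_{\mathcal X}h(x)^2dx$, and $$\mathcal G(c,C)=\Big\{g:\int_{\mathcal X}g(x)\,dx=1,\ c\le g\le C\text{ almost everywhere}\Big\}.$$ $P_J$ is the $L^2(dx)$-orthogonal projection onto the finite-dimensional level-$J$ scaling space $V_J\subset L^2(dx)$ of a fixed compactly supported, tensor-product, boundary-corrected orthonormal wavelet basis of Cohen–Daubechies–Vial type on $[0,1]^d$: $V_J=\operatorname{span}\{\varphi_{J,\lambda}:\lambda\in\Lambda_J\}$, where $(\varphi_{J,\lambda})_{\lambda\in\Lambda_J}$ is the orthonormal family of $2^{Jd}$ tensor products of one-dimensional level-$J$ interval scaling functions, defined for all levels $J\ge J_0$ with $J_0$ a fixed coarse level. *)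

theory Defs
  imports "HOL-Analysis.Analysis"
begin

section \<open>Real square-integrable functions\<close>

definition L2 :: "'a measure \<Rightarrow> ('a \<Rightarrow> real) set" where
  "L2 M = {f \<in> borel_measurable M. integrable M (\<lambda>x. (f x)\<^sup>2)}"

definition L2_inner :: "'a measure \<Rightarrow> ('a \<Rightarrow> real) \<Rightarrow> ('a \<Rightarrow> real) \<Rightarrow> real" where
  "L2_inner M f g = (LINT x|M. f x * g x)"

definition L2_norm :: "'a measure \<Rightarrow> ('a \<Rightarrow> real) \<Rightarrow> real" where
  "L2_norm M f = sqrt (LINT x|M. (f x)\<^sup>2)"

definition L2_orthonormal :: "'a measure \<Rightarrow> 'i set \<Rightarrow> ('i \<Rightarrow> 'a \<Rightarrow> real) \<Rightarrow> bool" where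
  "L2_orthonormal M I f \<longleftrightarrow>
     (\<forall>i\<in>I. f i \<in> L2 M) \<and>
     (\<forall>i\<in>I. \<forall>k\<in>I. L2_inner M (f i) (f k) = (if i = k then 1 else 0))"

definition lin_span :: "'i set \<Rightarrow> ('i \<Rightarrow> 'a \<Rightarrow> real) \<Rightarrow> ('a \<Rightarrow> real) set" where
  "lin_span I f = {h. \<exists>a. h = (\<lambda>x. \<Sum>i\<in>I. a i * f i x)}"

text \<open>Orthogonal projection onto a set \<open>V\<close> of square-integrable functions. The value is a
  representative in \<open>V\<close> of an almost-everywhere class; for the spaces used below it exists by
  \<open>L2_proj_lin_span\<close>.\<close>

definition L2_proj :: "'a measure \<Rightarrow> ('a \<Rightarrow> real) set \<Rightarrow> ('a \<Rightarrow> real) \<Rightarrow> ('a \<Rightarrow> real)" where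
  "L2_proj M V f = (SOME p. p \<in> V \<and> (\<forall>v\<in>V. L2_inner M (\<lambda>x. f x - p x) v = 0))"


section \<open>Cohen--Daubechies--Vial scaling functions on the unit interval\<close>

text \<open>\<open>\<phi>\<close> is a compactly supported orthonormal scaling function whose wavelet has \<open>N\<close> vanishing
  moments, with a filter \<open>h\<close> of minimal length \<open>2 * N\<close> and translated so that its support lies
  in \<open>[1 - N, N]\<close>. For \<open>N = 1\<close> this is the Haar system. A Borel representative of \<open>\<phi>\<close> is fixed;
  the refinement equation is an identity in the space of square-integrable functions.\<close>

definition daubechies_scaling :: "nat \<Rightarrow> (real \<Rightarrow> real) \<Rightarrow> bool" where
  "daubechies_scaling N \<phi> \<longleftrightarrow>
     1 \<le> N \<and>
     (\<forall>x. \<phi> x \<noteq> 0 \<longrightarrow> 1 - real N \<le> x \<and> x \<le> real N) \<and>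
     L2_orthonormal lborel UNIV (\<lambda>(m::int) x. \<phi> (x - of_int m)) \<and>
     (LINT x|lborel. \<phi> x) = 1 \<and>
     (\<exists>h :: int \<Rightarrow> real.
        (AE x in lborel. \<phi> x = sqrt 2 * (\<Sum>n\<in>{1 - int N..int N}. h n * \<phi> (2 * x - of_int n))) \<and>
        (\<forall>k<N. (LINT x|lborel. x ^ k *
            (sqrt 2 * (\<Sum>n\<in>{1 - int N..int N}. (-1) powi n * h (1 - n) * \<phi> (2 * x - of_int n)))) = 0))"

text \<open>The edge functions on the half-line before orthonormalization,
  \<open>\<Sum>n=k..2*N-2. (n choose k) * \<phi> (x + n - N + 1)\<close>. Modulo the interior translates
  \<open>\<phi> (x - m)\<close>, \<open>m \<ge> N\<close>, they restore the polynomials of degree less than \<open>N\<close> on the half-line.\<close>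

definition cdv_edge :: "nat \<Rightarrow> (real \<Rightarrow> real) \<Rightarrow> nat \<Rightarrow> real \<Rightarrow> real" where
  "cdv_edge N \<phi> k x = (\<Sum>n=k..2 * N - 2. real (n choose k) * \<phi> (x + real n - real N + 1))"

text \<open>Any orthonormalization of the edge functions on the half-line is allowed. Values at negative
  arguments are irrelevant.\<close>

definition cdv_edge_system :: "nat \<Rightarrow> (real \<Rightarrow> real) \<Rightarrow> (nat \<Rightarrow> real \<Rightarrow> real) \<Rightarrow> bool" where
  "cdv_edge_system N \<phi> e \<longleftrightarrow>
     L2_orthonormal (restrict_space lborel {0..}) {..<N} e \<and>
     (\<forall>k<N. \<exists>a. \<forall>x\<ge>0. e k x = (\<Sum>l<N. a l * cdv_edge N \<phi> l x))"

text \<open>The right edge is the left edge of the reflected scaling function \<open>\<lambda>x. \<phi> (1 - x)\<close>, whose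
  support again lies in \<open>[1 - N, N]\<close>. From the coarse level \<open>J0\<close> on there is room for \<open>N\<close> edge
  functions at each end.\<close>

definition cdv_system ::
  "nat \<Rightarrow> (real \<Rightarrow> real) \<Rightarrow> (nat \<Rightarrow> real \<Rightarrow> real) \<Rightarrow> (nat \<Rightarrow> real \<Rightarrow> real) \<Rightarrow> nat \<Rightarrow> bool" where
  "cdv_system N \<phi> eL eR J0 \<longleftrightarrow>
     daubechies_scaling N \<phi> \<and>
     cdv_edge_system N \<phi> eL \<and>
     cdv_edge_system N (\<lambda>x. \<phi> (1 - x)) eR \<and>
     2 * N \<le> 2 ^ J0"

definition cdv_scaling ::
  "nat \<Rightarrow> (real \<Rightarrow> real) \<Rightarrow> (nat \<Rightarrow> real \<Rightarrow> real) \<Rightarrow> (nat \<Rightarrow> real \<Rightarrow> real) \<Rightarrow>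
   nat \<Rightarrow> nat \<Rightarrow> real \<Rightarrow> real" where
  "cdv_scaling N \<phi> eL eR j k x = sqrt (2 ^ j) *
     (if k < N then eL k (2 ^ j * x)
      else if k < 2 ^ j - N then \<phi> (2 ^ j * x - real k)
      else eR (2 ^ j - 1 - k) (2 ^ j * (1 - x)))"


section \<open>Tensor products on the unit cube\<close>

abbreviation cube_measure :: "(real ^ 'd) measure" where
  "cube_measure \<equiv> lebesgue_on (cbox 0 1)"

definition level_index :: "nat \<Rightarrow> ('d \<Rightarrow> nat) set" where
  "level_index J = {l. \<forall>i. l i < 2 ^ J}"

definition cdv_tensor ::
  "nat \<Rightarrow> (real \<Rightarrow> real) \<Rightarrow> (nat \<Rightarrow> real \<Rightarrow> real) \<Rightarrow> (nat \<Rightarrow> real \<Rightarrow> real) \<Rightarrow>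
   nat \<Rightarrow> ('d \<Rightarrow> nat) \<Rightarrow> real ^ 'd \<Rightarrow> real" where
  "cdv_tensor N \<phi> eL eR J l x = (\<Prod>i\<in>UNIV. cdv_scaling N \<phi> eL eR J (l i) (x $ i))"

definition cdv_space ::
  "nat \<Rightarrow> (real \<Rightarrow> real) \<Rightarrow> (nat \<Rightarrow> real \<Rightarrow> real) \<Rightarrow> (nat \<Rightarrow> real \<Rightarrow> real) \<Rightarrow>
   nat \<Rightarrow> (real ^ 'd \<Rightarrow> real) set" where
  "cdv_space N \<phi> eL eR J = lin_span (level_index J) (cdv_tensor N \<phi> eL eR J)"

definition cdv_proj ::
  "nat \<Rightarrow> (real \<Rightarrow> real) \<Rightarrow> (nat \<Rightarrow> real \<Rightarrow> real) \<Rightarrow> (nat \<Rightarrow> real \<Rightarrow> real) \<Rightarrow>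
   nat \<Rightarrow> (real ^ 'd \<Rightarrow> real) \<Rightarrow> real ^ 'd \<Rightarrow> real" where
  "cdv_proj N \<phi> eL eR J = L2_proj cube_measure (cdv_space N \<phi> eL eR J)"

definition bounded_densities :: "real \<Rightarrow> real \<Rightarrow> (real ^ 'd \<Rightarrow> real) set" where
  "bounded_densities c C =
     {g \<in> borel_measurable cube_measure.
        (LINT x|cube_measure. g x) = 1 \<and> (AE x in cube_measure. c \<le> g x \<and> g x \<le> C)}"

definition cdv_quad ::
  "nat \<Rightarrow> (real \<Rightarrow> real) \<Rightarrow> (nat \<Rightarrow> real \<Rightarrow> real) \<Rightarrow> (nat \<Rightarrow> real \<Rightarrow> real) \<Rightarrow>
   nat \<Rightarrow> (real ^ 'd \<Rightarrow> real) \<Rightarrow> (real ^ 'd \<Rightarrow> real) \<Rightarrow> real" where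
  "cdv_quad N \<phi> eL eR J r g =
     (L2_norm cube_measure (cdv_proj N \<phi> eL eR J (\<lambda>x. r x * g x)))\<^sup>2"


section \<open>Well-definedness\<close>

lemma L2D:
  assumes "f \<in> L2 M"
  shows "f \<in> borel_measurable M" and "integrable M (\<lambda>x. (f x)\<^sup>2)"
  using assms by (auto simp: L2_def)

lemma L2_mult_integrable:
  assumes f: "f \<in> L2 M" and g: "g \<in> L2 M"
  shows "integrable M (\<lambda>x. f x * g x)"
proof (rule Bochner_Integration.integrable_bound)
  show "integrable M (\<lambda>x. (f x)\<^sup>2 + (g x)\<^sup>2)"
    using L2D[OF f] L2D[OF g] by auto
  show "(\<lambda>x. f x * g x) \<in> borel_measurable M"
    using L2D[OF f] L2D[OF g] by auto
  show "AE x in M. norm (f x * g x) \<le> norm ((f x)\<^sup>2 + (g x)\<^sup>2)"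
  proof (rule AE_I2)
    fix x
    have "0 \<le> (\<bar>f x\<bar> - \<bar>g x\<bar>)\<^sup>2" by simp
    then have "2 * (\<bar>f x\<bar> * \<bar>g x\<bar>) \<le> (f x)\<^sup>2 + (g x)\<^sup>2"
      by (simp add: power2_diff)
    moreover have "0 \<le> \<bar>f x\<bar> * \<bar>g x\<bar>" by simp
    ultimately have "\<bar>f x\<bar> * \<bar>g x\<bar> \<le> (f x)\<^sup>2 + (g x)\<^sup>2" by linarith
    then show "norm (f x * g x) \<le> norm ((f x)\<^sup>2 + (g x)\<^sup>2)"
      by (simp add: abs_mult)
  qed
qed

lemma L2_zero: "(\<lambda>x. 0) \<in> L2 M"
  by (simp add: L2_def)

lemma L2_scale: "f \<in> L2 M \<Longrightarrow> (\<lambda>x. a * f x) \<in> L2 M"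
  by (auto simp: L2_def power_mult_distrib)

lemma L2_add:
  assumes f: "f \<in> L2 M" and g: "g \<in> L2 M"
  shows "(\<lambda>x. f x + g x) \<in> L2 M"
  using L2_mult_integrable[OF f g] L2D[OF f] L2D[OF g]
  by (auto simp: L2_def power2_sum mult.assoc)

lemma L2_sum:
  assumes "\<And>i. i \<in> I \<Longrightarrow> f i \<in> L2 M"
  shows "(\<lambda>x. \<Sum>i\<in>I. a i * f i x) \<in> L2 M"
  using assms
proof (induction I rule: infinite_finite_induct)
  case (insert i F)
  then show ?case
    using L2_add[OF L2_scale[of "f i" M "a i"], of "\<lambda>x. \<Sum>i\<in>F. a i * f i x"] by simp
qed (auto intro: L2_zero)

lemma L2_inner_sum:
  assumes "\<And>i. i \<in> I \<Longrightarrow> f i \<in> L2 M" and "g \<in> L2 M"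
  shows "L2_inner M (\<lambda>x. \<Sum>i\<in>I. a i * f i x) g = (\<Sum>i\<in>I. a i * L2_inner M (f i) g)"
proof -
  have *: "integrable M (\<lambda>x. a i * (f i x * g x))" if "i \<in> I" for i
    using L2_mult_integrable[OF assms(1)[OF that] assms(2)] by simp
  have "L2_inner M (\<lambda>x. \<Sum>i\<in>I. a i * f i x) g = (LINT x|M. (\<Sum>i\<in>I. a i * (f i x * g x)))"
    unfolding L2_inner_def by (simp add: sum_distrib_right mult.assoc)
  also have "\<dots> = (\<Sum>i\<in>I. a i * L2_inner M (f i) g)"
    using * by (subst Bochner_Integration.integral_sum) (auto simp: L2_inner_def)
  finally show ?thesis .
qed

lemma L2_inner_commute: "L2_inner M f g = L2_inner M g f"
  by (simp add: L2_inner_def mult.commute)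

lemma L2_inner_diff:
  assumes "f \<in> L2 M" "g \<in> L2 M" "h \<in> L2 M"
  shows "L2_inner M (\<lambda>x. f x - g x) h = L2_inner M f h - L2_inner M g h"
  using L2_mult_integrable[OF assms(1,3)] L2_mult_integrable[OF assms(2,3)]
  by (simp add: L2_inner_def left_diff_distrib)

lemma L2_proj_lin_span:
  assumes I: "finite I" and o: "L2_orthonormal M I b" and f: "f \<in> L2 M"
  shows "L2_proj M (lin_span I b) f \<in> lin_span I b"
    and "v \<in> lin_span I b \<Longrightarrow> L2_inner M (\<lambda>x. f x - L2_proj M (lin_span I b) f x) v = 0"
proof -
  define p where "p = (\<lambda>x. \<Sum>i\<in>I. L2_inner M (b i) f * b i x)"
  have b: "b i \<in> L2 M" if "i \<in> I" for i
    using o that by (auto simp: L2_orthonormal_def)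
  have bb: "L2_inner M (b i) (b k) = (if i = k then 1 else 0)" if "i \<in> I" "k \<in> I" for i k
    using o that by (auto simp: L2_orthonormal_def)
  have p: "p \<in> L2 M" unfolding p_def by (rule L2_sum) (rule b)
  have pb: "L2_inner M p (b k) = L2_inner M (b k) f" if "k \<in> I" for k
    unfolding p_def using that I
    by (subst L2_inner_sum) (auto simp: b bb if_distrib sum.delta cong: if_cong)
  have fp: "(\<lambda>x. f x - p x) \<in> L2 M"
    using L2_add[OF f L2_scale[OF p, of "-1"]] by simp
  have "L2_inner M (\<lambda>x. f x - p x) v = 0" if v: "v \<in> lin_span I b" for v
  proof -
    obtain a where a: "v = (\<lambda>x. \<Sum>i\<in>I. a i * b i x)"
      using v by (auto simp: lin_span_def)
    have "L2_inner M (b i) (\<lambda>x. f x - p x) = 0" if "i \<in> I" for i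
      using L2_inner_diff[OF f p b[OF that]] pb[OF that] by (simp add: L2_inner_commute)
    then have "L2_inner M v (\<lambda>x. f x - p x) = 0"
      unfolding a by (subst L2_inner_sum) (auto simp: b fp)
    then show ?thesis by (simp add: L2_inner_commute)
  qed
  moreover have "p \<in> lin_span I b" by (auto simp: p_def lin_span_def)
  ultimately have ex: "\<exists>p. p \<in> lin_span I b \<and>
      (\<forall>v\<in>lin_span I b. L2_inner M (\<lambda>x. f x - p x) v = 0)"
    by blast
  show "L2_proj M (lin_span I b) f \<in> lin_span I b"
    and "v \<in> lin_span I b \<Longrightarrow> L2_inner M (\<lambda>x. f x - L2_proj M (lin_span I b) f x) v = 0"
    using someI_ex[OF ex] by (auto simp: L2_proj_def)
qed

lemma translate_comb_edge:
  assumes "1 \<le> N" "k < N"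
  shows "\<exists>b. \<forall>x. cdv_edge N \<phi> k x = (\<Sum>m\<in>{1 - int N..int N - 1}. b m * \<phi> (x - of_int m))"
proof (intro exI allI)
  fix x
  let ?b = "\<lambda>m. if nat (int N - 1 - m) \<in> {k..2 * N - 2}
              then real (nat (int N - 1 - m) choose k) else 0"
  have "cdv_edge N \<phi> k x = (\<Sum>n\<in>{0..2 * N - 2}.
      (if n \<in> {k..2 * N - 2} then real (n choose k) else 0) * \<phi> (x + real n - real N + 1))"
    unfolding cdv_edge_def by (rule sum.mono_neutral_cong_left) auto
  also have "\<dots> = (\<Sum>m\<in>{1 - int N..int N - 1}. ?b m * \<phi> (x - of_int m))"
  proof (rule sum.reindex_bij_witness[of _ "\<lambda>m. nat (int N - 1 - m)" "\<lambda>n. int N - 1 - int n"])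
    fix n assume n: "n \<in> {0..2 * N - 2}"
    show "nat (int N - 1 - (int N - 1 - int n)) = n" by simp
    show "int N - 1 - int n \<in> {1 - int N..int N - 1}" using n assms(1) by auto
    have "x - of_int (int N - 1 - int n) = x + real n - real N + 1" by simp
    then show "?b (int N - 1 - int n) * \<phi> (x - of_int (int N - 1 - int n)) =
        (if n \<in> {k..2 * N - 2} then real (n choose k) else 0) * \<phi> (x + real n - real N + 1)"
      by (simp only: \<open>nat (int N - 1 - (int N - 1 - int n)) = n\<close>)
  next
    fix m assume m: "m \<in> {1 - int N..int N - 1}"
    show "int N - 1 - int (nat (int N - 1 - m)) = m" using m by simp
    show "nat (int N - 1 - m) \<in> {0..2 * N - 2}" using m by auto
  qed
  finally show "cdv_edge N \<phi> k x = (\<Sum>m\<in>{1 - int N..int N - 1}. ?b m * \<phi> (x - of_int m))" .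
qed

lemma translate_comb_edge_system:
  assumes "1 \<le> N" "cdv_edge_system N \<phi> e" "k < N"
  shows "\<exists>b. \<forall>x\<ge>0. e k x = (\<Sum>m\<in>{1 - int N..int N - 1}. b m * \<phi> (x - of_int m))"
proof -
  obtain a where a: "\<And>x. x \<ge> 0 \<Longrightarrow> e k x = (\<Sum>l<N. a l * cdv_edge N \<phi> l x)"
    using assms by (auto simp: cdv_edge_system_def)
  have "\<forall>l. \<exists>b. l < N \<longrightarrow>
      (\<forall>x. cdv_edge N \<phi> l x = (\<Sum>m\<in>{1 - int N..int N - 1}. b m * \<phi> (x - of_int m)))"
    using translate_comb_edge[OF assms(1), of _ \<phi>] by simp
  then obtain b where b: "\<And>l x. l < N \<Longrightarrow>
      cdv_edge N \<phi> l x = (\<Sum>m\<in>{1 - int N..int N - 1}. b l m * \<phi> (x - of_int m))"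
    by metis
  have "e k x = (\<Sum>m\<in>{1 - int N..int N - 1}. (\<Sum>l<N. a l * b l m) * \<phi> (x - of_int m))"
    if "x \<ge> 0" for x
  proof -
    have "e k x = (\<Sum>l<N. \<Sum>m\<in>{1 - int N..int N - 1}. a l * b l m * \<phi> (x - of_int m))"
      using a[OF that] b by (simp add: sum_distrib_left mult.assoc)
    also have "\<dots> = (\<Sum>m\<in>{1 - int N..int N - 1}. \<Sum>l<N. a l * b l m * \<phi> (x - of_int m))"
      by (rule sum.swap)
    finally show ?thesis by (simp add: sum_distrib_right)
  qed
  then show ?thesis
    by (intro exI[of _ "\<lambda>m. \<Sum>l<N. a l * b l m"] allI impI)
qed

lemma L2_indicator:
  assumes "f \<in> L2 M" "A \<in> sets M"
  shows "(\<lambda>x. indicator A x * f x) \<in> L2 M"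
proof -
  have "integrable M (\<lambda>x. indicator A x *\<^sub>R (f x)\<^sup>2)"
    using L2D[OF assms(1)] assms(2) by (intro integrable_mult_indicator)
  moreover have "(\<lambda>x. (indicator A x * f x)\<^sup>2) = (\<lambda>x. indicator A x *\<^sub>R (f x)\<^sup>2)"
    by (auto simp: fun_eq_iff split: split_indicator)
  moreover have "(\<lambda>x. indicator A x * f x) \<in> borel_measurable M"
    using L2D[OF assms(1)] assms(2) by measurable
  ultimately show ?thesis by (simp add: L2_def)
qed

lemma comb_inner:
  fixes \<phi> :: "real \<Rightarrow> real"
  assumes o: "L2_orthonormal lborel UNIV (\<lambda>(m::int) x. \<phi> (x - of_int m))"
    and fin: "finite A" "finite B"
    and f: "\<And>y. y \<in> S \<Longrightarrow> f y = (\<Sum>m\<in>A. a m * \<phi> (y - of_int m))"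
    and g: "\<And>y. y \<in> S \<Longrightarrow> g y = (\<Sum>m\<in>B. b m * \<phi> (y - of_int m))"
    and S: "\<And>m n y. m \<in> A \<Longrightarrow> n \<in> B \<Longrightarrow> y \<notin> S \<Longrightarrow> \<phi> (y - of_int m) * \<phi> (y - of_int n) = 0"
  shows "(LINT y|lborel. indicator S y * (f y * g y)) =
           (\<Sum>m\<in>A. \<Sum>n\<in>B. a m * b n * (if m = n then 1 else 0))"
proof -
  let ?t = "\<lambda>(m::int) x. \<phi> (x - of_int m)"
  have t: "?t m \<in> L2 lborel" for m using o by (auto simp: L2_orthonormal_def)
  have tt: "L2_inner lborel (?t m) (?t n) = (if m = n then 1 else 0)" for m n
    using o by (auto simp: L2_orthonormal_def)
  let ?F = "\<lambda>x. \<Sum>m\<in>A. a m * ?t m x" and ?G = "\<lambda>x. \<Sum>m\<in>B. b m * ?t m x"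
  have "indicator S y * (f y * g y) = ?F y * ?G y" for y
  proof (cases "y \<in> S")
    case True then show ?thesis using f g by simp
  next
    case False
    have "?F y * ?G y = (\<Sum>m\<in>A. \<Sum>n\<in>B. (a m * b n) * (?t m y * ?t n y))"
      by (simp add: sum_product mult_ac)
    also have "\<dots> = 0"
      by (intro sum.neutral ballI) (use S False in auto)
    finally show ?thesis using False by simp
  qed
  then have "(LINT y|lborel. indicator S y * (f y * g y)) = L2_inner lborel ?F ?G"
    by (simp add: L2_inner_def)
  also have "\<dots> = (\<Sum>m\<in>A. a m * L2_inner lborel ?G (?t m))"
    using t by (subst L2_inner_sum) (auto intro: L2_sum simp: L2_inner_commute)
  also have "\<dots> = (\<Sum>m\<in>A. a m * (\<Sum>n\<in>B. b n * L2_inner lborel (?t n) (?t m)))"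
    using t by (subst L2_inner_sum) auto
  also have "\<dots> = (\<Sum>m\<in>A. \<Sum>n\<in>B. a m * b n * (if m = n then 1 else 0))"
    by (auto simp: tt sum_distrib_left mult.assoc intro!: sum.cong)
  finally show ?thesis .
qed

lemma edge_inner:
  assumes "1 \<le> N" and sys: "cdv_edge_system N \<phi> e"
    and supp: "\<And>x. \<phi> x \<noteq> 0 \<Longrightarrow> x \<le> real N"
    and T: "2 * real N \<le> T" and kl: "k < N" "l < N"
  shows "(LINT y|lborel. indicator {0..T} y * (e k y * e l y)) = (if k = l then 1 else 0)"
proof -
  have z: "e k y = 0" if y: "T < y" for y
  proof -
    obtain b where b: "\<And>x. x \<ge> 0 \<Longrightarrow> e k x = (\<Sum>m\<in>{1 - int N..int N - 1}. b m * \<phi> (x - of_int m))"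
      using translate_comb_edge_system[OF assms(1) sys kl(1)] by metis
    have "\<phi> (y - of_int m) = 0" if "m \<in> {1 - int N..int N - 1}" for m
    proof (rule ccontr)
      assume "\<phi> (y - of_int m) \<noteq> 0"
      then have "y - of_int m \<le> real N" by (rule supp)
      moreover have "real_of_int m \<le> real N - 1" using that by auto
      ultimately show False using y T by linarith
    qed
    moreover have "0 \<le> y" using y T by linarith
    ultimately show ?thesis by (simp add: b)
  qed
  have "indicator {0..T} y * (e k y * e l y) = indicator {0..} y *\<^sub>R (e k y * e l y)" for y
    using z[of y] by (cases "y \<le> T") (auto split: split_indicator)
  then have "(\<lambda>y. indicator {0..T} y * (e k y * e l y)) =
      (\<lambda>y. indicator {0..} y *\<^sub>R (e k y * e l y))"
    by (rule ext)
  then have "(LINT y|lborel. indicator {0..T} y * (e k y * e l y))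
      = L2_inner (restrict_space lborel {0..}) (e k) (e l)"
    unfolding L2_inner_def by (subst integral_restrict_space) simp_all
  also have "\<dots> = (if k = l then 1 else 0)"
    using sys kl unfolding cdv_edge_system_def L2_orthonormal_def by blast
  finally show ?thesis .
qed

lemma cdv_scaling_orthonormal:
  assumes sys: "cdv_system N \<phi> eL eR J0" and j: "J0 \<le> j"
  shows "L2_orthonormal (restrict_space lborel {0..1}) {..<2 ^ j} (cdv_scaling N \<phi> eL eR j)"
proof -
  define T :: nat where "T = 2 ^ j"
  define u where "u = (\<lambda>k y. if k < N then eL k y else if k < T - N then \<phi> (y - real k)
    else eR (T - 1 - k) (real T - y))"
  have "(2::nat) ^ J0 \<le> 2 ^ j" using j by simp
  then have NT: "2 * N \<le> T"
    unfolding T_def using sys by (auto simp: cdv_system_def intro: order_trans)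
  have ds: "daubechies_scaling N \<phi>" and L: "cdv_edge_system N \<phi> eL"
    and R: "cdv_edge_system N (\<lambda>x. \<phi> (1 - x)) eR"
    using sys by (auto simp: cdv_system_def)
  have N1: "1 \<le> N" and o: "L2_orthonormal lborel UNIV (\<lambda>(m::int) x. \<phi> (x - of_int m))"
    using ds by (auto simp: daubechies_scaling_def)
  have supp: "1 - real N \<le> x" "x \<le> real N" if "\<phi> x \<noteq> 0" for x
    using ds that by (auto simp: daubechies_scaling_def)
  have supp': "x \<le> real N" if "\<phi> (1 - x) \<noteq> 0" for x
    using supp[OF that] by linarith
  define A where "A = (\<lambda>k. if k < N then {1 - int N..int N - 1} else if k < T - N then {int k}
    else {int T - int N..int T + int N - 2})"
  define Q where "Q = (\<lambda>k b. (\<forall>y\<in>{0..real T}. u k y = (\<Sum>m\<in>A k. b m * \<phi> (y - of_int m))) \<and>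
      (N \<le> k \<and> k < T - N \<longrightarrow> b = (\<lambda>_. 1)))"
  have ex: "\<exists>b. (\<forall>y\<in>{0..real T}. u k y = (\<Sum>m\<in>A k. b m * \<phi> (y - of_int m))) \<and>
      (N \<le> k \<and> k < T - N \<longrightarrow> b = (\<lambda>_. 1))" if k: "k < T" for k
  proof -
    consider "k < N" | "N \<le> k" "k < T - N" | "N \<le> k" "T - N \<le> k" by linarith
    then show ?thesis
    proof cases
      case 1
      obtain b where "\<And>x. x \<ge> 0 \<Longrightarrow> eL k x = (\<Sum>m\<in>{1 - int N..int N - 1}. b m * \<phi> (x - of_int m))"
        using translate_comb_edge_system[OF N1 L 1] by metis
      then show ?thesis using 1 by (intro exI[of _ b]) (auto simp: u_def A_def)
    next
      case 2
      then show ?thesis by (intro exI[of _ "\<lambda>_. 1"]) (auto simp: u_def A_def)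
    next
      case 3
      have k': "T - 1 - k < N" using 3 k NT by linarith
      obtain b where b: "\<And>x. x \<ge> 0 \<Longrightarrow> eR (T - 1 - k) x =
          (\<Sum>m\<in>{1 - int N..int N - 1}. b m * \<phi> (1 - (x - of_int m)))"
        using translate_comb_edge_system[OF N1 R k'] by metis
      have "u k y = (\<Sum>m\<in>A k. b (int T - 1 - m) * \<phi> (y - of_int m))" if "y \<in> {0..real T}" for y
      proof -
        have "u k y = eR (T - 1 - k) (real T - y)" using 3 by (simp add: u_def)
        also have "\<dots> = (\<Sum>m\<in>{1 - int N..int N - 1}. b m * \<phi> (1 - (real T - y - of_int m)))"
          using that by (intro b) simp
        also have "\<dots> = (\<Sum>m\<in>{int T - int N..int T + int N - 2}. b (int T - 1 - m) * \<phi> (y - of_int m))"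
          by (rule sum.reindex_bij_witness[of _ "\<lambda>m. int T - 1 - m" "\<lambda>m. int T - 1 - m"])
             (auto intro!: arg_cong2[of _ _ _ _ "(*)"] arg_cong[of _ _ \<phi>])
        finally show ?thesis using 3 by (simp add: A_def)
      qed
      then show ?thesis using 3 by (intro exI[of _ "\<lambda>m. b (int T - 1 - m)"]) auto
    qed
  qed
  have "\<forall>k<T. \<exists>b. Q k b"
    unfolding Q_def by (intro allI impI, rule ex)

  then obtain b where b: "\<And>k. k < T \<Longrightarrow> Q k (b k)"
    by metis
  have rep: "u k y = (\<Sum>m\<in>A k. b k m * \<phi> (y - of_int m))" if "k < T" "y \<in> {0..real T}" for k y
    using b[OF that(1)] that(2) by (auto simp: Q_def)
  have b1: "b k = (\<lambda>_. 1)" if "k < T" "N \<le> k" "k < T - N" for k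
    using b[OF that(1)] that by (simp add: Q_def)
  have finA: "finite (A k)" for k by (simp add: A_def)
  have uL2: "(\<lambda>y. indicator {0..real T} y * u k y) \<in> L2 lborel" if "k < T" for k
  proof -
    have "(\<lambda>x. \<Sum>m\<in>A k. b k m * \<phi> (x - of_int m)) \<in> L2 lborel"
      using o by (intro L2_sum) (auto simp: L2_orthonormal_def)
    then have "(\<lambda>x. indicator {0..real T} x * (\<Sum>m\<in>A k. b k m * \<phi> (x - of_int m))) \<in> L2 lborel"
      by (rule L2_indicator) simp
    moreover have "(\<lambda>x. indicator {0..real T} x * (\<Sum>m\<in>A k. b k m * \<phi> (x - of_int m)))
        = (\<lambda>y. indicator {0..real T} y * u k y)"
      using rep[OF that] by (auto simp: fun_eq_iff split: split_indicator)
    ultimately show ?thesis by simp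
  qed
  have uu: "(LINT y|lborel. indicator {0..real T} y * (u k y * u l y)) = (if k = l then 1 else 0)"
    if k: "k < T" and l: "l < T" for k l
  proof -
    consider "k < N" "l < N" | "T - N \<le> k" "T - N \<le> l"
      | "\<not> (k < N \<and> l < N)" "\<not> (T - N \<le> k \<and> T - N \<le> l)" by linarith
    then show ?thesis
    proof cases
      case 1
      then show ?thesis
        using edge_inner[OF N1 L supp(2) _ 1, of "real T"] NT by (simp add: u_def)
    next
      case 2
      have *: "\<not> k < N" "\<not> l < N" "T - 1 - k < N" "T - 1 - l < N" "T - 1 - k = T - 1 - l \<longleftrightarrow> k = l"
        using 2 k l NT by linarith+
      have "(LINT y|lborel. indicator {0..real T} y * (u k y * u l y))
        = (LINT y|lborel. indicator {0..real T} (real T + (-1) * y) *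
            (u k (real T + (-1) * y) * u l (real T + (-1) * y)))"
        by (subst lborel_integral_real_affine[where c = "-1" and t = "real T"]) simp_all
      also have "\<dots> = (LINT y|lborel. indicator {0..real T} y * (eR (T - 1 - k) y * eR (T - 1 - l) y))"
        using 2 * by (intro Bochner_Integration.integral_cong)
          (auto simp: u_def split: split_indicator)
      also have "\<dots> = (if k = l then 1 else 0)"
        using edge_inner[OF N1 R supp' _ *(3,4), of "real T"] NT *(5) by simp
      finally show ?thesis .
    next
      case 3
      have "(LINT y|lborel. indicator {0..real T} y * (u k y * u l y)) =
          (\<Sum>m\<in>A k. \<Sum>n\<in>A l. b k m * b l n * (if m = n then 1 else 0))"
      proof (rule comb_inner[OF o finA finA rep[OF k] rep[OF l]])
        fix m n y assume m: "m \<in> A k" and n: "n \<in> A l" and y: "y \<notin> {0..real T}"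
        show "\<phi> (y - of_int m) * \<phi> (y - of_int n) = 0"
        proof (rule ccontr)
          assume "\<phi> (y - of_int m) * \<phi> (y - of_int n) \<noteq> 0"
          then have s: "1 - real N \<le> y - of_int m" "y - of_int m \<le> real N"
            "1 - real N \<le> y - of_int n" "y - of_int n \<le> real N"
            using supp[of "y - of_int m"] supp[of "y - of_int n"] by auto
          consider "y < 0" | "real T < y" using y by fastforce
          then show False
          proof cases
            case 1
            then have "real_of_int m < real_of_int (int N)" "real_of_int n < real_of_int (int N)"
              using s by simp_all
            then have "m < int N" "n < int N" by (simp_all only: of_int_less_iff)
            then show False using m n 3 k l NT by (auto simp: A_def split: if_splits)
          next
            case 2
            then have "real_of_int (int T - int N) < real_of_int m"
              "real_of_int (int T - int N) < real_of_int n"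
              using s by simp_all
            then have "int T - int N < m" "int T - int N < n" by (simp_all only: of_int_less_iff)
            then show False using m n 3 k l NT by (auto simp: A_def split: if_splits)
          qed
        qed
      qed auto
      also have "\<dots> = (if k = l then 1 else 0)"
      proof (cases "k = l")
        case True
        then have "N \<le> k" "k < T - N" using 3 by auto
        then show ?thesis using True k b1[of k] by (simp add: A_def)
      next
        case False
        then have "A k \<inter> A l = {}" using 3 k l NT by (auto simp: A_def)
        then have "m \<noteq> n" if "m \<in> A k" "n \<in> A l" for m n using that by auto
        then show ?thesis using False by (auto intro!: sum.neutral)
      qed
      finally show ?thesis .
    qed
  qed
  have Tpos: "0 < real T" by (simp add: T_def)
  have cs: "cdv_scaling N \<phi> eL eR j k x = sqrt (real T) * u k (real T * x)" for k x
    by (simp add: cdv_scaling_def u_def T_def right_diff_distrib)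
  have ind: "indicator {0..1} x = (indicator {0..real T} (real T * x) :: real)" for x :: real
    using Tpos by (auto split: split_indicator simp: zero_le_mult_iff mult_le_cancel_left_pos[of "real T" x 1, simplified])
  have ii: "indicator {0..1::real} x *\<^sub>R (cdv_scaling N \<phi> eL eR j k x * cdv_scaling N \<phi> eL eR j l x)
     = real T * (indicator {0..real T} (0 + real T * x) * (u k (0 + real T * x) * u l (0 + real T * x)))" for k l x
    unfolding cs ind using Tpos by (simp add: mult_ac flip: real_sqrt_mult)
  have int: "integrable lborel (\<lambda>y. indicator {0..real T} y * (u k y * u l y))" if "k < T" "l < T" for k l
  proof -
    have "(\<lambda>y. indicator {0..real T} y * (u k y * u l y)) =
        (\<lambda>y. (indicator {0..real T} y * u k y) * (indicator {0..real T} y * u l y))"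
      by (auto split: split_indicator)
    then show ?thesis using L2_mult_integrable[OF uL2 uL2, OF that] by simp
  qed
  have meas: "cdv_scaling N \<phi> eL eR j k \<in> borel_measurable (restrict_space lborel {0..1})"
    if "k < T" for k
  proof -
    have [measurable]: "(\<lambda>y. indicator {0..real T} y * u k y) \<in> borel_measurable borel"
      using L2D(1)[OF uL2[OF that]] by simp
    have "(\<lambda>x. sqrt (real T) * (indicator {0..real T} (real T * x) * u k (real T * x)))
        \<in> borel_measurable borel"
      by measurable
    moreover have "(\<lambda>x. sqrt (real T) * (indicator {0..real T} (real T * x) * u k (real T * x)))
        = (\<lambda>x. indicator {0..1} x *\<^sub>R cdv_scaling N \<phi> eL eR j k x)"
      unfolding cs ind by (auto simp: mult_ac)
    ultimately show ?thesis by (subst borel_measurable_restrict_space_iff) simp_all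
  qed
  show ?thesis
    unfolding L2_orthonormal_def
  proof (intro conjI ballI)
    fix k assume "k \<in> {..<(2::nat) ^ j}"
    then have k: "k < T" by (simp add: T_def)
    have "integrable (restrict_space lborel {0..1}) (\<lambda>x. cdv_scaling N \<phi> eL eR j k x * cdv_scaling N \<phi> eL eR j k x)"
      using lborel_integrable_real_affine[OF int[OF k k], of "real T" 0] Tpos
      by (subst integrable_restrict_space) (simp_all only: ii, auto)
    then show "cdv_scaling N \<phi> eL eR j k \<in> L2 (restrict_space lborel {0..1})"
      using meas[OF k] by (simp add: L2_def power2_eq_square)
  next
    fix k l assume "k \<in> {..<(2::nat) ^ j}" "l \<in> {..<(2::nat) ^ j}"
    then have k: "k < T" and l: "l < T" by (simp_all add: T_def)
    have "L2_inner (restrict_space lborel {0..1}) (cdv_scaling N \<phi> eL eR j k) (cdv_scaling N \<phi> eL eR j l)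
      = (LINT x|lborel. real T * (indicator {0..real T} (0 + real T * x) * (u k (0 + real T * x) * u l (0 + real T * x))))"
      unfolding L2_inner_def by (subst integral_restrict_space) (simp_all only: ii, auto)
    also have "\<dots> = (LINT y|lborel. indicator {0..real T} y * (u k y * u l y))"
      using Tpos lborel_integral_real_affine[of "real T" "\<lambda>y. indicator {0..real T} y * (u k y * u l y)" 0] by simp
    finally show "L2_inner (restrict_space lborel {0..1}) (cdv_scaling N \<phi> eL eR j k) (cdv_scaling N \<phi> eL eR j l)
      = (if k = l then 1 else 0)" using uu[OF k l] by simp
  qed
qed

lemma integral_lborel_prod:
  fixes F :: "'d::finite \<Rightarrow> real \<Rightarrow> real"
  assumes F: "\<And>i. integrable lborel (F i)"
  shows "integrable lborel (\<lambda>x :: real ^ 'd. \<Prod>i\<in>UNIV. F i (x $ i))"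
    and "(LINT x|(lborel :: (real ^ 'd) measure). (\<Prod>i\<in>UNIV. F i (x $ i)))
          = (\<Prod>i\<in>UNIV. LINT y|lborel. F i y)"
proof -
  interpret product_sigma_finite "\<lambda>_ :: real ^ 'd. lborel :: real measure" ..
  let ?a = "\<lambda>i. axis i (1::real) :: real ^ 'd"
  define G where "G b = F (inv ?a b)" for b
  have inj: "inj ?a" by (auto simp: inj_on_def axis_eq_axis)
  have Ga: "G (?a i) = F i" for i unfolding G_def inv_f_f[OF inj] ..
  have B: "Basis = range ?a" by (auto simp: Basis_vec_def)
  have Fm [measurable]: "F i \<in> borel_measurable borel" for i
    using borel_measurable_integrable[OF F] by simp
  have Gi: "integrable lborel (G b)" for b by (simp add: G_def F)
  have "(\<Prod>i\<in>UNIV. F i (x $ i)) = (\<Prod>b\<in>Basis. G b (x \<bullet> b))" for x :: "real ^ 'd"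
    unfolding B by (subst prod.reindex[OF inj]) (simp add: Ga cart_eq_inner_axis)
  then have eq: "(\<lambda>x. \<Prod>i\<in>UNIV. F i (x $ i)) = (\<lambda>x. \<Prod>b\<in>Basis. G b (x \<bullet> b))"
    by (rule ext)
  have comp: "(\<Prod>b\<in>Basis. G b ((\<Sum>b\<in>Basis. f b *\<^sub>R b) \<bullet> b)) = (\<Prod>b\<in>Basis. G b (f b))"
    for f :: "real ^ 'd \<Rightarrow> real"
    by (intro prod.cong) (auto simp: inner_sum_left_Basis)
  have m: "(\<lambda>x. \<Prod>b\<in>Basis. G b (x \<bullet> b)) \<in> borel_measurable (borel :: (real ^ 'd) measure)"
    unfolding eq[symmetric] by measurable
  show "integrable lborel (\<lambda>x :: real ^ 'd. \<Prod>i\<in>UNIV. F i (x $ i))"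
    unfolding eq using product_integrable_prod[of Basis G] Gi
    by (subst lborel_eq, subst integrable_distr_eq) (simp_all add: comp m)
  have "(LINT x|(lborel :: (real ^ 'd) measure). (\<Prod>i\<in>UNIV. F i (x $ i)))
      = (\<Prod>b\<in>(Basis :: (real ^ 'd) set). LINT y|lborel. G b y)"
    unfolding eq using product_integral_prod[of Basis G] Gi
    by (subst lborel_eq, subst integral_distr) (simp_all add: comp m)
  also have "\<dots> = (\<Prod>i\<in>UNIV. LINT y|lborel. F i y)"
    unfolding B by (subst prod.reindex[OF inj]) (simp add: Ga)
  finally show "(LINT x|(lborel :: (real ^ 'd) measure). (\<Prod>i\<in>UNIV. F i (x $ i)))
      = (\<Prod>i\<in>UNIV. LINT y|lborel. F i y)" .
qed

lemma indicator_cube_prod: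
  fixes f :: "'d::finite \<Rightarrow> real \<Rightarrow> real" and x :: "real ^ 'd"
  shows "indicator (cbox 0 1) x *\<^sub>R (\<Prod>i\<in>UNIV. f i (x $ i))
    = (\<Prod>i\<in>UNIV. indicator {0..1} (x $ i) * f i (x $ i))"
proof (cases "x \<in> cbox 0 1")
  case True
  then have "indicator {0..1} (x $ i) = (1::real)" for i by (simp add: mem_box_cart)
  then show ?thesis using True by simp
next
  case False
  then obtain i where "x $ i \<notin> {0..1}" by (auto simp: mem_box_cart)
  then have "indicator {0..1} (x $ i) * f i (x $ i) = 0" by simp
  then have "(\<Prod>i\<in>UNIV. indicator {0..1} (x $ i) * f i (x $ i)) = 0"
    by (intro prod_zero finite bexI[of _ i] UNIV_I)
  then show ?thesis using False by simp
qed

lemma integral_cube_prod: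
  fixes f :: "'d::finite \<Rightarrow> real \<Rightarrow> real"
  assumes f: "\<And>i. integrable (restrict_space lborel {0..1}) (f i)"
  shows "integrable cube_measure (\<lambda>x :: real ^ 'd. \<Prod>i\<in>UNIV. f i (x $ i))"
    and "(LINT x|(cube_measure :: (real ^ 'd) measure). (\<Prod>i\<in>UNIV. f i (x $ i)))
          = (\<Prod>i\<in>UNIV. LINT y|restrict_space lborel {0..1}. f i y)"
proof -
  let ?F = "\<lambda>i y. indicator {0..1} y * f i y"
  have F: "integrable lborel (?F i)" for i
    using f[of i] by (subst (asm) integrable_restrict_space) auto
  note P = integral_lborel_prod[of ?F, OF F]
  have m: "(\<lambda>x :: real ^ 'd. \<Prod>i\<in>UNIV. ?F i (x $ i)) \<in> borel_measurable lborel"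
    using P(1) by (rule borel_measurable_integrable)
  show "integrable cube_measure (\<lambda>x :: real ^ 'd. \<Prod>i\<in>UNIV. f i (x $ i))"
    using P(1) m by (subst integrable_restrict_space) (simp_all only: indicator_cube_prod integrable_completion, simp)
  have "(LINT x|(cube_measure :: (real ^ 'd) measure). (\<Prod>i\<in>UNIV. f i (x $ i)))
      = (LINT x|(lborel :: (real ^ 'd) measure). (\<Prod>i\<in>UNIV. ?F i (x $ i)))"
    using m by (subst integral_restrict_space) (simp_all only: indicator_cube_prod integral_completion, simp)
  also have "\<dots> = (\<Prod>i\<in>UNIV. LINT y|lborel. ?F i y)" by (rule P(2))
  also have "\<dots> = (\<Prod>i\<in>UNIV. LINT y|restrict_space lborel {0..1}. f i y)"
    by (intro prod.cong refl) (subst integral_restrict_space, auto)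
  finally show "(LINT x|(cube_measure :: (real ^ 'd) measure). (\<Prod>i\<in>UNIV. f i (x $ i)))
          = (\<Prod>i\<in>UNIV. LINT y|restrict_space lborel {0..1}. f i y)" .
qed

lemma finite_level_index: "finite (level_index J :: ('d::finite \<Rightarrow> nat) set)"
  and card_level_index: "card (level_index J :: ('d::finite \<Rightarrow> nat) set) = 2 ^ (J * CARD('d))"
proof -
  have *: "level_index J = (\<Pi>\<^sub>E i\<in>(UNIV :: 'd set). {..<2 ^ J :: nat})"
    by (auto simp: level_index_def PiE_def)
  show "finite (level_index J :: ('d \<Rightarrow> nat) set)"
    unfolding * by (rule finite_PiE) auto
  show "card (level_index J :: ('d \<Rightarrow> nat) set) = 2 ^ (J * CARD('d))"
    unfolding * by (simp add: card_PiE power_mult)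
qed

lemma cdv_tensor_orthonormal:
  assumes sys: "cdv_system N \<phi> eL eR J0" and J: "J0 \<le> J"
  shows "L2_orthonormal (cube_measure :: (real ^ 'd) measure) (level_index J)
           (cdv_tensor N \<phi> eL eR J)"
proof -
  let ?M = "restrict_space lborel {0..1::real}"
  let ?s = "cdv_scaling N \<phi> eL eR J"
  note o = cdv_scaling_orthonormal[OF sys J, unfolded L2_orthonormal_def]
  have s: "?s k \<in> L2 ?M" if "k < 2 ^ J" for k using o that by blast
  have ss: "(LINT y|?M. ?s k y * ?s l y) = (if k = l then 1 else 0)" if "k < 2 ^ J" "l < 2 ^ J" for k l
    using o that unfolding L2_inner_def by blast
  have int: "integrable ?M (\<lambda>y. ?s (p i) y * ?s (q i) y)"
    if "p \<in> level_index J" "q \<in> level_index J" for p q :: "'d \<Rightarrow> nat" and i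
    using that by (intro L2_mult_integrable s) (auto simp: level_index_def)
  have prod: "cdv_tensor N \<phi> eL eR J p x * cdv_tensor N \<phi> eL eR J q x
      = (\<Prod>i\<in>UNIV. ?s (p i) (x $ i) * ?s (q i) (x $ i))" for p q :: "'d \<Rightarrow> nat" and x
    by (simp add: cdv_tensor_def prod.distrib)
  show ?thesis
    unfolding L2_orthonormal_def
  proof (intro conjI ballI)
    fix p :: "'d \<Rightarrow> nat" assume p: "p \<in> level_index J"
    have "integrable ?M (?s (p i))" for i
    proof -
      have "(\<lambda>_. 1) \<in> L2 ?M"
        by (auto simp: L2_def integrable_restrict_space)
      from L2_mult_integrable[OF s this, of "p i"] show ?thesis
        using p by (simp add: level_index_def)
    qed
    from integral_cube_prod(1)[OF this]
    have "cdv_tensor N \<phi> eL eR J p \<in> borel_measurable (cube_measure :: (real ^ 'd) measure)"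
      unfolding cdv_tensor_def[abs_def] by (rule borel_measurable_integrable)
    then show "cdv_tensor N \<phi> eL eR J p \<in> L2 cube_measure"
      using integral_cube_prod(1)[of "\<lambda>i y. ?s (p i) y * ?s (p i) y", OF int[OF p p]]
      by (simp add: L2_def power2_eq_square prod)
  next
    fix p q :: "'d \<Rightarrow> nat" assume p: "p \<in> level_index J" and q: "q \<in> level_index J"
    have "L2_inner cube_measure (cdv_tensor N \<phi> eL eR J p) (cdv_tensor N \<phi> eL eR J q)
        = (\<Prod>i\<in>UNIV. LINT y|?M. ?s (p i) y * ?s (q i) y)"
      unfolding L2_inner_def prod by (rule integral_cube_prod(2)) (rule int[OF p q])
    also have "\<dots> = (\<Prod>i\<in>UNIV. if p i = q i then 1 else 0)"
      using p q by (intro prod.cong refl ss) (auto simp: level_index_def)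
    also have "\<dots> = (if p = q then 1 else 0)"
      by (auto simp: fun_eq_iff intro: prod_zero)
    finally show "L2_inner cube_measure (cdv_tensor N \<phi> eL eR J p) (cdv_tensor N \<phi> eL eR J q)
        = (if p = q then 1 else 0)" .
  qed
qed

corollary cdv_proj_orthogonal:
  fixes f :: "real ^ 'd \<Rightarrow> real"
  assumes "cdv_system N \<phi> eL eR J0" and "J0 \<le> J" and "f \<in> L2 cube_measure"
  shows "cdv_proj N \<phi> eL eR J f \<in> cdv_space N \<phi> eL eR J"
    and "v \<in> cdv_space N \<phi> eL eR J \<Longrightarrow>
           L2_inner cube_measure (\<lambda>x. f x - cdv_proj N \<phi> eL eR J f x) v = 0"
  using L2_proj_lin_span[OF finite_level_index cdv_tensor_orthonormal[OF assms(1,2)] assms(3)]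
  by (simp_all add: cdv_proj_def cdv_space_def)

end

theory Submission
  imports Defs
begin

text \<open>
  Multiplication by \<open>g\<close> distorts the geometry of the space of square-integrable functions by a
  bounded amount only. Since \<open>0 \<le> g \<le> C\<close>, it increases norms by a factor of at most \<open>C\<close>; the
  orthogonal projection \<open>P\<close> is a contraction, and the upper bound for \<open>\<parallel>P(rg)\<parallel>\<close> follows.
  Since \<open>g \<ge> c\<close>, it is bounded below as a quadratic form: \<open>\<integral> g v\<^sup>2 \<ge> c \<parallel>v\<parallel>\<^sup>2\<close>.

  For the lower bound, \<open>P(rg)\<close> is tested against the single function \<open>p = P r\<close>. Since \<open>p\<close> is in
  the range of \<open>P\<close>, the projection can be dropped, and with \<open>w = r - p\<close> this gives
  \<open>\<parallel>P(rg)\<parallel> \<parallel>p\<parallel> \<ge> \<langle>P(rg), p\<rangle> = \<langle>rg, p\<rangle> = \<integral> g p\<^sup>2 + \<langle>wg, p\<rangle> \<ge> c \<parallel>p\<parallel>\<^sup>2 - C \<parallel>w\<parallel> \<parallel>p\<parallel>\<close>.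
  Dividing by \<open>\<parallel>p\<parallel>\<close> yields the second inequality (\<open>norm_projected_product_ge\<close>). The last two
  follow by arithmetic from \<open>\<parallel>r\<parallel>\<^sup>2 = \<parallel>p\<parallel>\<^sup>2 + \<parallel>w\<parallel>\<^sup>2\<close>.

  The wavelet construction enters through the orthonormality of the finitely many tensor scaling
  functions of level \<open>J\<close>, which guarantees that the orthogonal projection onto their span exists.
\<close>

lemma L2_diff:
  assumes "f \<in> L2 M" and "g \<in> L2 M"
  shows "(\<lambda>x. f x - g x) \<in> L2 M"
  using L2_add[OF assms(1) L2_scale[OF assms(2), of "-1"]] by simp

lemma lin_span_L2:
  assumes "L2_orthonormal M I b"
  shows "lin_span I b \<subseteq> L2 M"
  using assms by (auto simp: lin_span_def L2_orthonormal_def intro!: L2_sum)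

lemma L2_norm_nonneg: "0 \<le> L2_norm M f"
  by (simp add: L2_norm_def)

lemma L2_norm_squared: "(L2_norm M f)\<^sup>2 = L2_inner M f f"
  by (simp add: L2_norm_def L2_inner_def power2_eq_square)

lemma L2_norm_diff_squared:
  assumes f: "f \<in> L2 M" and g: "g \<in> L2 M"
  shows "(L2_norm M (\<lambda>x. f x - g x))\<^sup>2
    = (L2_norm M f)\<^sup>2 - 2 * L2_inner M f g + (L2_norm M g)\<^sup>2"
  using L2_inner_diff[OF f g L2_diff[OF f g]] L2_inner_diff[OF f g f] L2_inner_diff[OF f g g]
  by (simp add: L2_norm_squared L2_inner_commute)

lemma L2_norm_scale: "L2_norm M (\<lambda>x. a * f x) = \<bar>a\<bar> * L2_norm M f"
  by (simp add: L2_norm_def power_mult_distrib real_sqrt_mult)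

lemma L2_inner_scale_right: "L2_inner M f (\<lambda>x. a * g x) = a * L2_inner M f g"
  by (simp add: L2_inner_def mult.left_commute)

lemma nonneg_quadratic_discriminant:
  fixes a b d :: real
  assumes nonneg: "\<And>t. 0 \<le> a - 2 * t * b + t\<^sup>2 * d" and "0 \<le> d"
  shows "b\<^sup>2 \<le> a * d"
proof (cases "d = 0")
  case True
  \<comment> \<open>The polynomial in \<open>t\<close> is affine and bounded below, hence has slope zero.\<close>
  have "b = 0"
  proof (rule ccontr)
    assume "b \<noteq> 0"
    then show False using nonneg[of "(a + 1) / (2 * b)"] True by simp
  qed
  then show ?thesis using True by simp
next
  case False
  then have d: "0 < d" using \<open>0 \<le> d\<close> by simp
  then have "a - 2 * (b / d) * b + (b / d)\<^sup>2 * d = a - b\<^sup>2 / d"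
    by (simp add: power2_eq_square)
  then have "b\<^sup>2 / d \<le> a" using nonneg[of "b / d"] by simp
  then show ?thesis using d by (simp add: pos_divide_le_eq)
qed

lemma L2_Cauchy_Schwarz:
  assumes f: "f \<in> L2 M" and g: "g \<in> L2 M"
  shows "\<bar>L2_inner M f g\<bar> \<le> L2_norm M f * L2_norm M g"
proof -
  let ?A = "(L2_norm M f)\<^sup>2" and ?B = "L2_inner M f g" and ?D = "(L2_norm M g)\<^sup>2"
  have quadratic: "0 \<le> ?A - 2 * t * ?B + t\<^sup>2 * ?D" for t
    using L2_norm_diff_squared[OF f L2_scale[OF g, of t]]
    by (simp add: L2_norm_scale L2_inner_scale_right power_mult_distrib mult.assoc)
      (metis zero_le_power2)
  have "?B\<^sup>2 \<le> ?A * ?D"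
    using nonneg_quadratic_discriminant[OF quadratic] by simp
  then have "?B\<^sup>2 \<le> (L2_norm M f * L2_norm M g)\<^sup>2"
    by (simp add: power_mult_distrib)
  then have "\<bar>?B\<bar> \<le> \<bar>L2_norm M f * L2_norm M g\<bar>"
    by (simp only: abs_le_square_iff)
  then show ?thesis by (simp add: L2_norm_nonneg)
qed

lemma L2_Pythagoras:
  assumes f: "f \<in> L2 M" and p: "p \<in> L2 M"
    and orth: "L2_inner M (\<lambda>x. f x - p x) p = 0"
  shows "(L2_norm M f)\<^sup>2 = (L2_norm M p)\<^sup>2 + (L2_norm M (\<lambda>x. f x - p x))\<^sup>2"
  using L2_norm_diff_squared[OF f p] L2_inner_diff[OF f p p] orth
  by (simp add: L2_norm_squared)

corollary L2_orthogonal_projection_norm_le: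
  assumes "f \<in> L2 M" and "p \<in> L2 M" and "L2_inner M (\<lambda>x. f x - p x) p = 0"
  shows "L2_norm M p \<le> L2_norm M f"
  using L2_Pythagoras[OF assms] L2_norm_nonneg[of M f]
  by (auto intro: power2_le_imp_le)

lemma L2_mult_bounded:
  assumes f: "f \<in> L2 M" and g: "g \<in> borel_measurable M"
    and bound: "AE x in M. \<bar>g x\<bar> \<le> C" and C: "0 \<le> C"
  shows "(\<lambda>x. f x * g x) \<in> L2 M"
    and "L2_norm M (\<lambda>x. f x * g x) \<le> C * L2_norm M f"
proof -
  have le: "AE x in M. (f x * g x)\<^sup>2 \<le> C\<^sup>2 * (f x)\<^sup>2"
    using bound
  proof eventually_elim
    case (elim x)
    then have "(g x)\<^sup>2 \<le> C\<^sup>2" using C by (simp add: abs_le_square_iff[symmetric])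
    then have "(f x)\<^sup>2 * (g x)\<^sup>2 \<le> (f x)\<^sup>2 * C\<^sup>2" by (rule mult_left_mono) simp
    then show ?case by (simp add: power_mult_distrib mult.commute)
  qed
  have dom: "integrable M (\<lambda>x. C\<^sup>2 * (f x)\<^sup>2)" using L2D(2)[OF f] by simp
  have meas: "(\<lambda>x. f x * g x) \<in> borel_measurable M" using L2D(1)[OF f] g by simp
  have int: "integrable M (\<lambda>x. (f x * g x)\<^sup>2)"
    using dom
  proof (rule Bochner_Integration.integrable_bound)
    show "(\<lambda>x. (f x * g x)\<^sup>2) \<in> borel_measurable M" using meas by simp
    show "AE x in M. norm ((f x * g x)\<^sup>2) \<le> norm (C\<^sup>2 * (f x)\<^sup>2)" using le by simp
  qed
  show "(\<lambda>x. f x * g x) \<in> L2 M" using meas int by (simp add: L2_def)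
  have "(LINT x|M. (f x * g x)\<^sup>2) \<le> (LINT x|M. C\<^sup>2 * (f x)\<^sup>2)"
    using int dom le by (rule integral_mono_AE)
  then have "L2_norm M (\<lambda>x. f x * g x) \<le> sqrt (C\<^sup>2 * (LINT x|M. (f x)\<^sup>2))"
    unfolding L2_norm_def by (intro real_sqrt_le_mono) simp
  then show "L2_norm M (\<lambda>x. f x * g x) \<le> C * L2_norm M f"
    using C by (simp add: L2_norm_def real_sqrt_mult)
qed

lemma L2_weighted_square_ge:
  assumes f: "f \<in> L2 M" and fg: "(\<lambda>x. f x * g x) \<in> L2 M"
    and bound: "AE x in M. c \<le> g x"
  shows "c * (L2_norm M f)\<^sup>2 \<le> L2_inner M (\<lambda>x. f x * g x) f"
proof -
  have "(LINT x|M. c * (f x)\<^sup>2) \<le> (LINT x|M. f x * g x * f x)"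
  proof (rule integral_mono_AE)
    show "integrable M (\<lambda>x. c * (f x)\<^sup>2)" using L2D(2)[OF f] by simp
    show "integrable M (\<lambda>x. f x * g x * f x)" by (rule L2_mult_integrable[OF fg f])
    show "AE x in M. c * (f x)\<^sup>2 \<le> f x * g x * f x"
      using bound
    proof eventually_elim
      case (elim x)
      then have "c * (f x)\<^sup>2 \<le> g x * (f x)\<^sup>2" by (rule mult_right_mono) simp
      then show ?case by (simp add: power2_eq_square mult_ac)
    qed
  qed
  then show ?thesis by (simp only: L2_norm_squared L2_inner_def) (simp add: power2_eq_square)
qed

text \<open>The orthogonality hypothesis says that testing \<open>q\<close> against \<open>p\<close> gives the same result as
  testing the product \<open>r g\<close>. It holds when \<open>q\<close> is the orthogonal projection of \<open>r g\<close> onto a space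
  that contains \<open>p\<close>. Replacing \<open>r\<close> by \<open>p\<close> in the tested product makes it a weighted square, and
  the error is controlled by \<open>r - p\<close>.\<close>

lemma norm_projected_product_ge:
  assumes r: "r \<in> L2 M" and p: "p \<in> L2 M" and q: "q \<in> L2 M"
    and g: "g \<in> borel_measurable M" and bounds: "AE x in M. c \<le> g x \<and> g x \<le> C"
    and c: "0 \<le> c" and C: "0 \<le> C"
    and orth: "L2_inner M (\<lambda>x. r x * g x - q x) p = 0"
  shows "c * L2_norm M p - C * L2_norm M (\<lambda>x. r x - p x) \<le> L2_norm M q"
proof -
  let ?w = "\<lambda>x. r x - p x"
  have abs_bound: "AE x in M. \<bar>g x\<bar> \<le> C" and lower: "AE x in M. c \<le> g x"
    using bounds c by auto
  note mult = L2_mult_bounded[OF _ g abs_bound C]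
  have w: "?w \<in> L2 M" by (rule L2_diff[OF r p])
  have "L2_inner M q p = L2_inner M (\<lambda>x. r x * g x) p"
    using orth L2_inner_diff[OF mult(1)[OF r] q p] by simp
  also have "\<dots> = L2_inner M (\<lambda>x. p x * g x) p + L2_inner M (\<lambda>x. ?w x * g x) p"
    using L2_inner_diff[OF mult(1)[OF r] mult(1)[OF p] p] by (simp add: left_diff_distrib)
  finally have split: "L2_inner M q p
      = L2_inner M (\<lambda>x. p x * g x) p + L2_inner M (\<lambda>x. ?w x * g x) p" .
  have "\<bar>L2_inner M (\<lambda>x. ?w x * g x) p\<bar> \<le> L2_norm M (\<lambda>x. ?w x * g x) * L2_norm M p"
    by (rule L2_Cauchy_Schwarz[OF mult(1)[OF w] p])
  also have "\<dots> \<le> C * L2_norm M ?w * L2_norm M p"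
    by (intro mult_right_mono mult(2)[OF w] L2_norm_nonneg)
  finally have cross: "\<bar>L2_inner M (\<lambda>x. ?w x * g x) p\<bar> \<le> C * L2_norm M ?w * L2_norm M p" .
  have "c * (L2_norm M p)\<^sup>2 - C * L2_norm M ?w * L2_norm M p \<le> L2_norm M q * L2_norm M p"
    using split cross L2_weighted_square_ge[OF p mult(1)[OF p] lower] L2_Cauchy_Schwarz[OF q p]
    by linarith
  then have *: "(c * L2_norm M p - C * L2_norm M ?w) * L2_norm M p \<le> L2_norm M q * L2_norm M p"
    by (simp add: power2_eq_square algebra_simps)
  show ?thesis
  proof (cases "L2_norm M p = 0")
    case True
    have "0 \<le> C * L2_norm M ?w" using C by (simp add: L2_norm_nonneg)
    then show ?thesis using True L2_norm_nonneg[of M q] by simp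
  next
    case False
    then have "0 < L2_norm M p" using L2_norm_nonneg[of M p] by simp
    with * show ?thesis by (rule mult_right_le_imp_le)
  qed
qed

text \<open>Here \<open>R\<close>, \<open>P\<close>, \<open>W\<close> stand for the norms of \<open>r\<close>, its projection and the remainder, and \<open>Q\<close>
  for the norm of the projected product. The first bound uses \<open>R \<le> P + W\<close>; the second keeps
  \<open>R\<^sup>2 = P\<^sup>2 + W\<^sup>2\<close>, which is the source of the summand \<open>1\<close> in the coefficient of \<open>W\<^sup>2\<close>, and
  squares \<open>c P \<le> Q + C W\<close> at the cost of the factor \<open>2\<close>.\<close>

lemma norm_bounds_from_Pythagoras:
  fixes c C P Q R W :: real
  assumes c: "0 < c" and nonneg: "0 \<le> P" "0 \<le> W"
    and pyth: "R\<^sup>2 = P\<^sup>2 + W\<^sup>2" and lower: "c * P - C * W \<le> Q"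
  shows "c * R - (c + C) * W \<le> Q"
    and "R\<^sup>2 \<le> 2 / c\<^sup>2 * Q\<^sup>2 + (1 + 2 * C\<^sup>2 / c\<^sup>2) * W\<^sup>2"
proof -
  have "R\<^sup>2 \<le> (P + W)\<^sup>2" using pyth nonneg by (simp add: power2_sum)
  then have "R \<le> P + W" by (rule power2_le_imp_le) (use nonneg in simp)
  then have "c * R \<le> c * (P + W)" using c by (intro mult_left_mono) auto
  then show "c * R - (c + C) * W \<le> Q" using lower by (simp add: algebra_simps)
  have "(c * P)\<^sup>2 \<le> (Q + C * W)\<^sup>2" using lower c nonneg by (intro power_mono) auto
  also have "\<dots> \<le> 2 * Q\<^sup>2 + 2 * (C * W)\<^sup>2"
    using zero_le_power2[of "Q - C * W"] by (simp only: power2_sum power2_diff)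
  finally have "P\<^sup>2 \<le> (2 * Q\<^sup>2 + 2 * (C * W)\<^sup>2) / c\<^sup>2"
    using c by (simp add: pos_le_divide_eq power_mult_distrib mult.commute)
  then show "R\<^sup>2 \<le> 2 / c\<^sup>2 * Q\<^sup>2 + (1 + 2 * C\<^sup>2 / c\<^sup>2) * W\<^sup>2"
    using pyth by (simp add: add_divide_distrib power_mult_distrib algebra_simps)
qed

theorem lemma2p2:
  fixes N J0 J :: nat
    and \<phi> :: "real \<Rightarrow> real"
    and eL eR :: "nat \<Rightarrow> real \<Rightarrow> real"
    and c C :: real
    and r g :: "real ^ 'd \<Rightarrow> real"
  assumes "cdv_system N \<phi> eL eR J0"
    and "0 < c" and "c \<le> 1" and "1 \<le> C"
    and "J0 \<le> J"
    and "r \<in> L2 cube_measure"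
    and "g \<in> bounded_densities c C"
  shows "sqrt (cdv_quad N \<phi> eL eR J r g) \<le> C * L2_norm cube_measure r
    \<and> sqrt (cdv_quad N \<phi> eL eR J r g)
        \<ge> c * L2_norm cube_measure (cdv_proj N \<phi> eL eR J r)
          - C * L2_norm cube_measure (\<lambda>x. r x - cdv_proj N \<phi> eL eR J r x)
    \<and> sqrt (cdv_quad N \<phi> eL eR J r g)
        \<ge> c * L2_norm cube_measure r
          - (c + C) * L2_norm cube_measure (\<lambda>x. r x - cdv_proj N \<phi> eL eR J r x)
    \<and> (L2_norm cube_measure r)\<^sup>2
        \<le> 2 / c\<^sup>2 * cdv_quad N \<phi> eL eR J r g
          + (1 + 2 * C\<^sup>2 / c\<^sup>2)
            * (L2_norm cube_measure (\<lambda>x. r x - cdv_proj N \<phi> eL eR J r x))\<^sup>2"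
proof -
  let ?M = "cube_measure :: (real ^ 'd) measure"
  let ?P = "cdv_proj N \<phi> eL eR J :: (real ^ 'd \<Rightarrow> real) \<Rightarrow> real ^ 'd \<Rightarrow> real"
  let ?q = "?P (\<lambda>x. r x * g x)"
  have r: "r \<in> L2 ?M" by fact
  have g: "g \<in> borel_measurable ?M" and bounds: "AE x in ?M. c \<le> g x \<and> g x \<le> C"
    using assms(7) by (auto simp: bounded_densities_def)
  have abs_bound: "AE x in ?M. \<bar>g x\<bar> \<le> C"
    using bounds \<open>0 < c\<close> by auto
  have C: "0 \<le> C" using \<open>1 \<le> C\<close> by simp
  note product = L2_mult_bounded[OF r g abs_bound C]
  note proj = cdv_proj_orthogonal[OF assms(1,5)]
  have space: "cdv_space N \<phi> eL eR J \<subseteq> L2 ?M"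
    unfolding cdv_space_def by (rule lin_span_L2[OF cdv_tensor_orthonormal[OF assms(1,5)]])
  have p: "?P r \<in> L2 ?M" and q: "?q \<in> L2 ?M"
    using proj(1)[OF r] proj(1)[OF product(1)] space by auto
  have root: "sqrt (cdv_quad N \<phi> eL eR J r g) = L2_norm ?M ?q"
    by (simp add: cdv_quad_def L2_norm_nonneg)
  have upper: "L2_norm ?M ?q \<le> C * L2_norm ?M r"
    using L2_orthogonal_projection_norm_le[OF product(1) q
        proj(2)[OF product(1) proj(1)[OF product(1)]]] product(2)
    by simp
  have lower: "c * L2_norm ?M (?P r) - C * L2_norm ?M (\<lambda>x. r x - ?P r x) \<le> L2_norm ?M ?q"
    using norm_projected_product_ge[OF r p q g bounds _ C
        proj(2)[OF product(1) proj(1)[OF r]]] \<open>0 < c\<close>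
    by simp
  have pyth: "(L2_norm ?M r)\<^sup>2 = (L2_norm ?M (?P r))\<^sup>2 + (L2_norm ?M (\<lambda>x. r x - ?P r x))\<^sup>2"
    by (rule L2_Pythagoras[OF r p proj(2)[OF r proj(1)[OF r]]])
  note rest = norm_bounds_from_Pythagoras[OF \<open>0 < c\<close> L2_norm_nonneg L2_norm_nonneg pyth lower]
  show ?thesis
    unfolding root using upper lower rest by (simp add: cdv_quad_def)
qed

end
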